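(* Let $a\geq b>0$ and consider the hyperbola $$\frac{x^{2}}{a^{2}}-\frac{y^{2}}{b^{2}}=1 .$$ Then its (limit) hyperbolic excess $\mathscr{E}(0)$ is $$\mathscr{E}(0)=\sqrt{a^2+b^2}\;\boldsymbol{E}\!\left(\frac{a}{\sqrt{a^2+b^2}}\right)-\frac{b^2}{\sqrt{a^2+b^2}}\;\boldsymbol{K}\!\left(\frac{a}{\sqrt{a^2+b^2}}\right).$$
   Context: Complete elliptic integrals are taken as functions of the modulus $k\in[0,1)$: $$\boldsymbol{K}(k)=\int_0^{\pi/2}\frac{d\theta}{\sqrt{1-k^2\sin^2\theta}},\qquad \boldsymbol{E}(k)=\int_0^{\pi/2}\sqrt{1-k^2\sin^2\theta}\,d\theta .$$ Hyperbolic excess: let $O=(0,0)$ be the centre of the hyperbola and $A=(a,0)$ its vertex. For a point $E\neq A$ on the arc of the hyperbola lying in the first quadrant ($x>0$, $y>0$), let $\tau$ be the tangent line to the hyperbola at $E$, and let $P$ be the foot of the perpendicular drawn from $O$ to $\tau$. The excess at $E$ is $\overline{PE}-\mathrm{length}(\text{arc }AE)$, where $\overline{PE}$ is the length of the segment $PE$ and arc $AE$ is the arc of the hyperbola from $A$ to $E$. Parametrize $E$ by its distance $\varepsilon>0$ from the asymptote $y=(b/a)x$ (equivalently, after rotating the axes so that this asymptote becomes the vertical axis, by the new abscissa $\varepsilon=\frac{bx-ay}{\sqrt{a^2+b^2}}$ of $E=(x,y)$, with $0<\varepsilon<\frac{ab}{\sqrt{a^2+b^2}}$), and denote the excess at $E$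 by $\mathscr{E}(\varepsilon)$. The (limit) hyperbolic excess is $\mathscr{E}(0):=\lim_{\varepsilon\to0^+}\mathscr{E}(\varepsilon)$, i.e. the limit of the excess as $E$ goes to infinity along the first-quadrant arc. *)

theory Defs
  imports "HOL-Analysis.Analysis"
begin

text \<open>Both integrals are functions of the modulus \<open>k\<close>, not of the parameter \<open>m = k\<^sup>2\<close>.\<close>

definition elliptic_K :: "real \<Rightarrow> real" where
  "elliptic_K k = integral {0..pi/2} (\<lambda>\<theta>. 1 / sqrt (1 - k\<^sup>2 * (sin \<theta>)\<^sup>2))"

definition elliptic_E :: "real \<Rightarrow> real" where
  "elliptic_E k = integral {0..pi/2} (\<lambda>\<theta>. sqrt (1 - k\<^sup>2 * (sin \<theta>)\<^sup>2))"

text \<open>The supremum of the lengths of the inscribed polygons. As a supremum in \<open>real\<close> it is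
  meaningful for rectifiable curves only.\<close>

definition curve_length :: "(real \<Rightarrow> 'a::metric_space) \<Rightarrow> real \<Rightarrow> real \<Rightarrow> real" where
  "curve_length \<gamma> u v =
     Sup {(\<Sum>i<n. dist (\<gamma> (s i)) (\<gamma> (s (Suc i)))) | (n::nat) (s :: nat \<Rightarrow> real).
            mono_on {..n} s \<and> s 0 = u \<and> s n = v}"

definition tangent_line :: "(real \<Rightarrow> 'a::real_normed_vector) \<Rightarrow> real \<Rightarrow> 'a set" where
  "tangent_line \<gamma> t = {\<gamma> t + r *\<^sub>R vector_derivative \<gamma> (at t) | r. True}"

definition perpendicular_foot :: "'a::real_inner \<Rightarrow> 'a set \<Rightarrow> 'a" where
  "perpendicular_foot p l = (THE q. q \<in> l \<and> (\<forall>r\<in>l. orthogonal (q - p) (r - q)))"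

definition hyperbola :: "real \<Rightarrow> real \<Rightarrow> (real \<times> real) set" where
  "hyperbola a b = {(x, y). x\<^sup>2 / a\<^sup>2 - y\<^sup>2 / b\<^sup>2 = 1}"

text \<open>The right branch parametrized by the ordinate, which, unlike the abscissa, gives a curve that
  is smooth also at the vertex \<open>(a, 0)\<close>, the point with parameter \<open>0\<close>.\<close>

definition right_branch :: "real \<Rightarrow> real \<Rightarrow> real \<Rightarrow> real \<times> real" where
  "right_branch a b y = (a * sqrt (1 + y\<^sup>2 / b\<^sup>2), y)"

lemma range_right_branch:
  assumes "a > 0" "b > 0"
  shows "range (right_branch a b) = {(x, y) \<in> hyperbola a b. x > 0}"
proof -
  have pos: "1 + y\<^sup>2 / b\<^sup>2 > 0" for y :: real
    by (simp add: add_pos_nonneg)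
  have "x = a * sqrt (1 + y\<^sup>2 / b\<^sup>2)" if "x\<^sup>2 / a\<^sup>2 - y\<^sup>2 / b\<^sup>2 = 1" "x > 0" for x y :: real
  proof -
    have "1 + y\<^sup>2 / b\<^sup>2 = (x / a)\<^sup>2"
      using that(1) by (simp add: power_divide)
    then show ?thesis
      using that(2) assms by simp
  qed
  moreover have "(a * sqrt (1 + y\<^sup>2 / b\<^sup>2))\<^sup>2 / a\<^sup>2 - y\<^sup>2 / b\<^sup>2 = 1" for y :: real
    using pos[of y] assms by (simp add: power_mult_distrib)
  moreover have "a * sqrt (1 + y\<^sup>2 / b\<^sup>2) > 0" for y :: real
    using pos[of y] assms by simp
  ultimately show ?thesis
    unfolding hyperbola_def right_branch_def by (auto simp: image_def)
qed

definition excess_at :: "real \<Rightarrow> real \<Rightarrow> real \<times> real \<Rightarrow> real" where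
  "excess_at a b E =
     (let P = perpendicular_foot (0, 0) (tangent_line (right_branch a b) (snd E))
      in dist P E - curve_length (right_branch a b) 0 (snd E))"

definition asymptote :: "real \<Rightarrow> real \<Rightarrow> (real \<times> real) set" where
  "asymptote a b = {(x, y). y = b / a * x}"

text \<open>For \<open>0 < \<epsilon> < a b / sqrt (a\<^sup>2 + b\<^sup>2)\<close> exactly one point of the first-quadrant arc has
  distance \<open>\<epsilon>\<close> from the asymptote; for other \<open>\<epsilon>\<close> the value is irrelevant.\<close>

definition arc_point :: "real \<Rightarrow> real \<Rightarrow> real \<Rightarrow> real \<times> real" where
  "arc_point a b \<epsilon> =
     (THE E. E \<in> hyperbola a b \<and> fst E > 0 \<and> snd E > 0 \<and> infdist E (asymptote a b) = \<epsilon>)"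

definition hyperbolic_excess :: "real \<Rightarrow> real \<Rightarrow> real \<Rightarrow> real" where
  "hyperbolic_excess a b \<epsilon> = excess_at a b (arc_point a b \<epsilon>)"

end

theory Submission
  imports Defs "HOL-Real_Asymp.Real_Asymp"
begin

text \<open>Put \<open>c = sqrt (a\<^sup>2 + b\<^sup>2)\<close>, \<open>k = a / c\<close>, \<open>\<Delta> \<theta> = sqrt (1 - k\<^sup>2 * (sin \<theta>)\<^sup>2)\<close> and describe the point of the
  branch with ordinate \<open>y\<close> by the amplitude \<open>\<phi> = arctan (c * y / b\<^sup>2)\<close>. The speed of the
  parametrization by \<open>y\<close> is \<open>1 / \<Delta> \<phi>\<close> and the tangent segment has length \<open>c * tan \<phi> * \<Delta> \<phi>\<close>.
  Differentiating with respect to \<open>\<phi>\<close>, the excess has derivative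
  \<open>c * k\<^sup>2 * (cos \<phi>)\<^sup>2 / \<Delta> \<phi> = c * \<Delta> \<phi> - b\<^sup>2 / (c * \<Delta> \<phi>)\<close>: the two parts that blow up at
  \<open>\<pi> / 2\<close> cancel. Hence the excess is the integral of this bounded function over \<open>{0..\<phi>}\<close>, and
  \<open>\<phi>\<close> tends to \<open>\<pi> / 2\<close> as the point goes to infinity.\<close>

section \<open>Arc length of continuously differentiable curves\<close>

text \<open>Let \<open>F\<close> be an antiderivative of the speed. The mean value inequality bounds
  each chord by the increment of \<open>F\<close>, so no inscribed polygon exceeds
  \<open>F v - F u\<close>. Uniform continuity of \<open>\<gamma>'\<close> shows that fine
  equidistant polygons come arbitrarily close.\<close>

lemma curve_length_C1:
  fixes \<gamma> :: "real \<Rightarrow> 'a::real_normed_vector"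
  assumes "u \<le> v"
    and deriv: "\<And>t. t \<in> {u..v} \<Longrightarrow> (\<gamma> has_vector_derivative \<gamma>' t) (at t within {u..v})"
    and cont: "continuous_on {u..v} \<gamma>'"
  shows "curve_length \<gamma> u v = integral {u..v} (\<lambda>t. norm (\<gamma>' t))"
proof -
  have cont_norm: "continuous_on {u..v} (\<lambda>t. norm (\<gamma>' t))"
    using cont by (rule continuous_on_norm)
  obtain F where F: "\<And>t. t \<in> {u..v} \<Longrightarrow>
      (F has_vector_derivative norm (\<gamma>' t)) (at t within {u..v})"
    using antiderivative_continuous[OF cont_norm] by blast
  have I: "integral {u..v} (\<lambda>t. norm (\<gamma>' t)) = F v - F u"
    using fundamental_theorem_of_calculus[OF \<open>u \<le> v\<close> F] by (simp add: integral_unique)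
  have F_sub: "(F has_vector_derivative norm (\<gamma>' x)) (at x within {s..t})"
    and \<gamma>_sub: "(\<gamma> has_vector_derivative \<gamma>' x) (at x within {s..t})"
    if "u \<le> s" "t \<le> v" "x \<in> {s..t}" for s t x
    using that by (auto intro!: has_vector_derivative_within_subset[OF F]
        has_vector_derivative_within_subset[OF deriv])
  have chord_le: "dist (\<gamma> s) (\<gamma> t) \<le> F t - F s" if "u \<le> s" "s \<le> t" "t \<le> v" for s t
  proof (cases "s = t")
    case False
    with that have "s < t" by simp
    moreover have "continuous_on {s..t} \<gamma>"
      using \<gamma>_sub[OF that(1,3)] by (rule continuous_on_vector_derivative)
    moreover have "continuous_on {s..t} F"
      using F_sub[OF that(1,3)] by (rule continuous_on_vector_derivative)
    moreover have "(\<gamma> has_vector_derivative \<gamma>' x) (at x)"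
      "(F has_vector_derivative norm (\<gamma>' x)) (at x)" if "s < x" "x < t" for x
      using that \<open>u \<le> s\<close> \<open>t \<le> v\<close> \<gamma>_sub[of s t x] F_sub[of s t x]
      by (simp_all add: at_within_Icc_at)
    ultimately have "norm (\<gamma> t - \<gamma> s) \<le> F t - F s"
      by (intro differentiable_bound_general[where f' = \<gamma>' and \<phi>' = "\<lambda>x. norm (\<gamma>' x)"]) auto
    then show ?thesis by (simp add: dist_norm norm_minus_commute)
  qed simp
  define S where "S = {(\<Sum>i<n. dist (\<gamma> (s i)) (\<gamma> (s (Suc i)))) | (n::nat) (s :: nat \<Rightarrow> real).
            mono_on {..n} s \<and> s 0 = u \<and> s n = v}"
  have upper: "z \<le> F v - F u" if "z \<in> S" for z
  proof -
    from that obtain n s where z: "z = (\<Sum>i<n. dist (\<gamma> (s i)) (\<gamma> (s (Suc i))))"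
      and s: "mono_on {..n} s" "s 0 = u" "s n = v"
      by (auto simp: S_def)
    have "z \<le> (\<Sum>i<n. F (s (Suc i)) - F (s i))"
      unfolding z
    proof (rule sum_mono)
      fix i assume "i \<in> {..<n}"
      then have "s 0 \<le> s i" "s i \<le> s (Suc i)" "s (Suc i) \<le> s n"
        by (auto intro!: mono_onD[OF s(1)])
      with s show "dist (\<gamma> (s i)) (\<gamma> (s (Suc i))) \<le> F (s (Suc i)) - F (s i)"
        by (intro chord_le) auto
    qed
    also have "\<dots> = F v - F u"
      using s(2,3) sum_lessThan_telescope[of "\<lambda>i. F (s i)" n] by simp
    finally show ?thesis .
  qed
  \<comment> \<open>The loss is \<open>e\<close> per unit of parameter, so that it adds up over a
    partition independently of the number of pieces.\<close>
  have lower: "\<exists>z\<in>S. F v - F u - e * (v - u) \<le> z" if "e > 0" for e :: real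
  proof -
    have "uniformly_continuous_on {u..v} \<gamma>'"
      using cont by (simp add: compact_uniformly_continuous)
    then obtain d where "d > 0" and d:
      "\<And>x y. \<lbrakk>x \<in> {u..v}; y \<in> {u..v}; dist x y < d\<rbrakk> \<Longrightarrow> dist (\<gamma>' x) (\<gamma>' y) < e"
      unfolding uniformly_continuous_on_def using \<open>e > 0\<close> by metis
    have chord_ge: "F t - F s - e * (t - s) \<le> dist (\<gamma> s) (\<gamma> t)"
      if "u \<le> s" "s \<le> t" "t \<le> v" "t - s < d" for s t
    proof (cases "s = t")
      case False
      with that have "s < t" by simp
      have "(F has_derivative (\<lambda>h. h *\<^sub>R norm (\<gamma>' x))) (at x within {s..t})"
        if "s \<le> x" "x \<le> t" for x
        using F_sub[OF \<open>u \<le> s\<close> \<open>t \<le> v\<close>, of x] that by (simp add: has_vector_derivative_def)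
      \<comment> \<open>The mean value theorem expresses the increment of \<open>F\<close> by the
        speed at one point \<open>x\<close>. Linearizing \<open>\<gamma>\<close> with the velocity
        at that same \<open>x\<close> makes chord and increment comparable.\<close>
      from mvt_simple[OF \<open>s < t\<close> this]
      obtain x where x: "x \<in> {s<..<t}" "F t - F s = (t - s) * norm (\<gamma>' x)"
        by auto
      have "norm (\<gamma> t - \<gamma> s - (t - s) *\<^sub>R \<gamma>' x) \<le> norm (t - s) * e"
      proof (rule vector_differentiable_bound_linearization[where S = "{s..t}"])
        fix y assume "y \<in> {s..t}"
        then show "(\<gamma> has_vector_derivative \<gamma>' y) (at y within {s..t})"
          using that by (intro \<gamma>_sub)
        have "dist (\<gamma>' y) (\<gamma>' x) < e"
          using that x \<open>y \<in> {s..t}\<close> by (intro d) (auto simp: dist_real_def)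
        then show "norm (\<gamma>' y - \<gamma>' x) \<le> e"
          by (simp add: dist_norm)
      qed (use x \<open>s < t\<close> in \<open>auto simp: closed_segment_eq_real_ivl\<close>)
      moreover have "norm ((t - s) *\<^sub>R \<gamma>' x) = F t - F s"
        using x \<open>s < t\<close> by simp
      moreover have "norm ((t - s) *\<^sub>R \<gamma>' x)
          \<le> norm (\<gamma> t - \<gamma> s) + norm (\<gamma> t - \<gamma> s - (t - s) *\<^sub>R \<gamma>' x)"
        using norm_triangle_sub[of "(t - s) *\<^sub>R \<gamma>' x" "\<gamma> t - \<gamma> s"]
        by (simp add: norm_minus_commute)
      ultimately show ?thesis
        using \<open>s < t\<close> by (simp add: dist_norm norm_minus_commute mult.commute)
    qed simp
    \<comment> \<open>This \<open>n\<close> makes the mesh smaller than \<open>d\<close>; the strict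
      inequality gives \<open>n > 0\<close> even if \<open>u = v\<close>.\<close>
    obtain n :: nat where n: "(v - u) / d < real n"
      using reals_Archimedean2 by blast
    then have "n > 0"
      using \<open>u \<le> v\<close> \<open>d > 0\<close> by (cases n) (auto simp: divide_less_0_iff)
    define h where "h = (v - u) / n"
    define s where "s i = u + real i * h" for i
    have h: "0 \<le> h" "h < d" "n * h = v - u"
      using n \<open>n > 0\<close> \<open>u \<le> v\<close> \<open>d > 0\<close> by (simp_all add: h_def field_simps)
    have s: "mono s" "s 0 = u" "s n = v" "\<And>i. s (Suc i) = s i + h"
      using h by (auto simp: s_def mono_def algebra_simps intro!: mult_left_mono)
    have "F v - F u - e * (v - u) = (\<Sum>i<n. F (s (Suc i)) - F (s i) - e * (s (Suc i) - s i))"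
      using s(2,3) sum_lessThan_telescope[of "\<lambda>i. F (s i) - e * s i" n]
      by (simp add: algebra_simps)
    also have "\<dots> \<le> (\<Sum>i<n. dist (\<gamma> (s i)) (\<gamma> (s (Suc i))))"
    proof (rule sum_mono)
      fix i assume "i \<in> {..<n}"
      then have "s 0 \<le> s i" "s i \<le> s (Suc i)" "s (Suc i) \<le> s n"
        by (auto intro!: monoD[OF s(1)])
      with s h show "F (s (Suc i)) - F (s i) - e * (s (Suc i) - s i)
          \<le> dist (\<gamma> (s i)) (\<gamma> (s (Suc i)))"
        by (intro chord_ge) auto
    qed
    finally show ?thesis
      using s by (force simp: S_def intro: mono_imp_mono_on)
  qed
  have "Sup S = F v - F u"
  proof (rule cSup_eq_non_empty)
    show "S \<noteq> {}" using lower[of 1] by auto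
    fix w assume w: "\<And>z. z \<in> S \<Longrightarrow> z \<le> w"
    show "F v - F u \<le> w"
    proof (rule field_le_epsilon)
      fix e :: real assume "e > 0"
      \<comment> \<open>The summand 1 keeps the denominator positive when
        \<open>u = v\<close>.\<close>
      define e' where "e' = e / (v - u + 1)"
      have "e' > 0" "e' * (v - u) \<le> e"
        using \<open>e > 0\<close> \<open>u \<le> v\<close> by (simp_all add: e'_def field_simps)
      then show "F v - F u \<le> w + e"
        using lower[of e'] w by fastforce
    qed
  qed (use upper in auto)
  then show ?thesis
    by (simp add: curve_length_def S_def I)
qed

section \<open>Perpendicular feet and distances to lines\<close>

lemma perpendicular_foot_line:
  fixes p q d :: "'a::real_inner"
  assumes "d \<noteq> 0"
  shows "perpendicular_foot p {q + r *\<^sub>R d | r. True} = q + (((p - q) \<bullet> d) / (d \<bullet> d)) *\<^sub>R d"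
proof -
  let ?l = "{q + r *\<^sub>R d | r. True}" and ?r = "((p - q) \<bullet> d) / (d \<bullet> d)"
  have "d \<bullet> d \<noteq> 0" using assms by simp
  have foot_iff: "(\<forall>z\<in>?l. orthogonal (q + r *\<^sub>R d - p) (z - (q + r *\<^sub>R d))) \<longleftrightarrow> r = ?r" for r
  proof
    assume *: "\<forall>z\<in>?l. orthogonal (q + r *\<^sub>R d - p) (z - (q + r *\<^sub>R d))"
    \<comment> \<open>This test point differs from the candidate foot by exactly \<open>d\<close>,
      so one orthogonality condition yields a linear equation for \<open>r\<close>.\<close>
    have "q + (r + 1) *\<^sub>R d \<in> ?l" by blast
    with * have "orthogonal (q + r *\<^sub>R d - p) (q + (r + 1) *\<^sub>R d - (q + r *\<^sub>R d))" by blast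
    then show "r = ?r"
      using \<open>d \<bullet> d \<noteq> 0\<close> by (simp add: orthogonal_def field_simps inner_simps)
  next
    assume "r = ?r"
    then have "(q + r *\<^sub>R d - p) \<bullet> d = 0"
      using \<open>d \<bullet> d \<noteq> 0\<close> by (simp add: inner_simps)
    then have "orthogonal (q + r *\<^sub>R d - p) ((r' - r) *\<^sub>R d)" for r'
      by (simp add: orthogonal_def)
    then show "\<forall>z\<in>?l. orthogonal (q + r *\<^sub>R d - p) (z - (q + r *\<^sub>R d))"
      by (auto simp: scaleR_diff_left)
  qed
  show ?thesis
    unfolding perpendicular_foot_def
  proof (rule the_equality)
    show "q + ?r *\<^sub>R d \<in> ?l \<and> (\<forall>z\<in>?l. orthogonal (q + ?r *\<^sub>R d - p) (z - (q + ?r *\<^sub>R d)))"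
      using foot_iff[of ?r] by blast
  next
    fix z assume z: "z \<in> ?l \<and> (\<forall>r\<in>?l. orthogonal (z - p) (r - z))"
    then obtain r where r: "z = q + r *\<^sub>R d" by blast
    have "r = ?r"
      using conjunct2[OF z] unfolding r by (rule foot_iff[THEN iffD1])
    then show "z = q + ?r *\<^sub>R d" using r by simp
  qed
qed

text \<open>The vector \<open>(b, -a)\<close> is normal to the asymptote. Moving along it reaches a
  point of the line at the claimed distance, and Cauchy-Schwarz against it shows that no point is
  closer.\<close>

lemma infdist_asymptote:
  assumes "a > 0"
  shows "infdist (x, y) (asymptote a b) = \<bar>b * x - a * y\<bar> / sqrt (a\<^sup>2 + b\<^sup>2)"
proof (rule antisym)
  let ?c = "sqrt (a\<^sup>2 + b\<^sup>2)"
  have pos: "a\<^sup>2 + b\<^sup>2 > 0" using assms by (simp add: add_pos_nonneg)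
  \<comment> \<open>\<open>m\<close> is the multiple of \<open>(b, -a)\<close> whose subtraction
    from \<open>(x, y)\<close> lands on the asymptote.\<close>
  define m where "m = (b * x - a * y) / (a\<^sup>2 + b\<^sup>2)"
  have m: "m * (a\<^sup>2 + b\<^sup>2) = b * x - a * y" using pos by (simp add: m_def)
  have "(x - b * m, y + a * m) \<in> asymptote a b"
    using m assms by (simp add: asymptote_def field_simps power2_eq_square)
  then have "infdist (x, y) (asymptote a b) \<le> dist (x, y) (x - b * m, y + a * m)"
    by (rule infdist_le)
  also have "\<dots> = sqrt (m\<^sup>2 * (a\<^sup>2 + b\<^sup>2))"
    by (simp add: dist_Pair_Pair dist_real_def power_mult_distrib algebra_simps)
  also have "\<dots> = \<bar>b * x - a * y\<bar> / ?c"
    unfolding m[symmetric] using pos by (simp add: real_sqrt_mult abs_mult real_div_sqrt flip: times_divide_eq_right)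
  finally show "infdist (x, y) (asymptote a b) \<le> \<bar>b * x - a * y\<bar> / ?c" .
  have ne: "asymptote a b \<noteq> {}" by (auto simp: asymptote_def)
  have "\<bar>b * x - a * y\<bar> / ?c \<le> dist (x, y) p" if "p \<in> asymptote a b" for p
  proof -
    define s where "s = fst p"
    have p: "p = (s, b / a * s)"
      using that by (auto simp: asymptote_def s_def)
    have "b * x - a * y = (b, - a) \<bullet> ((x, y) - p)"
      using assms by (simp add: p field_simps)
    then have "\<bar>b * x - a * y\<bar> \<le> norm (b, - a) * norm ((x, y) - p)"
      by (metis Cauchy_Schwarz_ineq2)
    then show ?thesis
      using pos by (simp add: norm_Pair dist_norm field_simps add.commute)
  qed
  then show "\<bar>b * x - a * y\<bar> / ?c \<le> infdist (x, y) (asymptote a b)"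
    using ne by (auto simp: infdist_def intro!: cINF_greatest)
qed

section \<open>Points and tangents of the right branch\<close>

lemma right_branch_has_vector_derivative:
  assumes "b > 0"
  shows "(right_branch a b has_vector_derivative (a * y / (b\<^sup>2 * sqrt (1 + y\<^sup>2 / b\<^sup>2)), 1)) (at y)"
proof -
  have pos: "1 + y\<^sup>2 / b\<^sup>2 > 0" by (simp add: add_pos_nonneg)
  have "((\<lambda>y. a * sqrt (1 + y\<^sup>2 / b\<^sup>2)) has_real_derivative a * y / (b\<^sup>2 * sqrt (1 + y\<^sup>2 / b\<^sup>2))) (at y)"
    using pos assms by (auto intro!: derivative_eq_intros simp: field_simps)
  then show ?thesis
    unfolding right_branch_def[abs_def] has_real_derivative_iff_has_vector_derivative
    by (intro has_vector_derivative_Pair has_vector_derivative_id)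
qed

text \<open>The equation of the hyperbola factors as
  \<open>(b * x - a * y) * (b * x + a * y) = a\<^sup>2 * b\<^sup>2\<close>. The distance prescribes
  the first factor, hence also the second, and the resulting linear system determines the
  point.\<close>

lemma arc_point_eq:
  assumes "a > 0" "b > 0" "0 < \<epsilon>" "\<epsilon> < a * b / sqrt (a\<^sup>2 + b\<^sup>2)"
  defines "d \<equiv> sqrt (a\<^sup>2 + b\<^sup>2) * \<epsilon>"
  shows "arc_point a b \<epsilon> = right_branch a b ((a\<^sup>2 * b\<^sup>2 / d - d) / (2 * a))"
proof -
  define x where "x = (a\<^sup>2 * b\<^sup>2 / d + d) / (2 * b)"
  define y where "y = (a\<^sup>2 * b\<^sup>2 / d - d) / (2 * a)"
  have c: "sqrt (a\<^sup>2 + b\<^sup>2) > 0" using assms by (simp add: add_pos_pos)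
  have d: "0 < d" "d < a * b" using assms c by (simp_all add: d_def field_simps)
  have lines: "b * x - a * y = d" "b * x + a * y = a\<^sup>2 * b\<^sup>2 / d"
    using assms(1,2) d by (simp_all add: x_def y_def field_simps)
  have hyp_iff: "(p, q) \<in> hyperbola a b \<longleftrightarrow> (b * p - a * q) * (b * p + a * q) = a\<^sup>2 * b\<^sup>2" for p q
    using assms(1,2) by (auto simp: hyperbola_def field_simps power2_eq_square)
  have dist_iff: "infdist (p, q) (asymptote a b) = \<epsilon> \<longleftrightarrow> \<bar>b * p - a * q\<bar> = d" for p q
    using assms(1) c by (simp add: infdist_asymptote d_def field_simps)
  \<comment> \<open>This is where the upper bound on \<epsilon> enters: it makes the ordinate
    \<open>y\<close> positive.\<close>
  have "d * d < (a * b) * (a * b)"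
    using d by (intro mult_strict_mono) auto
  then have "d < a\<^sup>2 * b\<^sup>2 / d"
    using d by (simp add: field_simps power2_eq_square)
  then have "x > 0" "y > 0"
    using assms(1,2) d by (simp_all add: x_def y_def add_pos_pos)
  have "arc_point a b \<epsilon> = (x, y)"
    unfolding arc_point_def
  proof (rule the_equality)
    show "(x, y) \<in> hyperbola a b \<and> 0 < fst (x, y) \<and> 0 < snd (x, y) \<and>
        infdist (x, y) (asymptote a b) = \<epsilon>"
      using \<open>x > 0\<close> \<open>y > 0\<close> d by (simp add: hyp_iff dist_iff lines)
  next
    fix E assume E: "E \<in> hyperbola a b \<and> 0 < fst E \<and> 0 < snd E \<and>
        infdist E (asymptote a b) = \<epsilon>"
    obtain p q where pq: "E = (p, q)" by (cases E)
    with E have *: "(b * p - a * q) * (b * p + a * q) = a\<^sup>2 * b\<^sup>2" "p > 0" "q > 0"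
      "\<bar>b * p - a * q\<bar> = d"
      by (simp_all add: hyp_iff dist_iff)
    \<comment> \<open>The distance gives the first factor only up to sign; the product and the
      second factor are positive, so the first is too.\<close>
    have "b * p + a * q > 0" "a\<^sup>2 * b\<^sup>2 > 0"
      using * assms(1,2) by (simp_all add: add_pos_pos)
    then have "b * p - a * q > 0"
      using *(1) by (metis zero_less_mult_pos2)
    with * have 1: "b * p - a * q = d" by simp
    with *(1) have "d * (b * p + a * q) = a\<^sup>2 * b\<^sup>2" by simp
    with d have 2: "b * p + a * q = a\<^sup>2 * b\<^sup>2 / d" by (simp add: field_simps)
    from 1 2 have "2 * b * p = a\<^sup>2 * b\<^sup>2 / d + d" "2 * a * q = a\<^sup>2 * b\<^sup>2 / d - d"
      by linarith+
    then have "p = x" "q = y"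
      using assms(1,2) by (simp_all add: x_def y_def eq_divide_eq mult.commute)
    then show "E = (x, y)" by (simp add: pq)
  qed
  moreover have "(x, y) \<in> range (right_branch a b)"
    using \<open>x > 0\<close> d by (simp add: range_right_branch[OF assms(1,2)] hyp_iff lines)
  then have "(x, y) = right_branch a b y"
    by (auto simp: right_branch_def)
  ultimately show ?thesis by (simp add: y_def)
qed

text \<open>The component of the position vector along the tangent is the segment sought. In the
  inner product with \<open>v\<close> the square roots cancel, leaving a multiple of
  \<open>y\<close>.\<close>

lemma tangent_foot_distance:
  fixes a b y :: real
  assumes "b > 0" "y \<ge> 0"
  defines "v \<equiv> (a * y / (b\<^sup>2 * sqrt (1 + y\<^sup>2 / b\<^sup>2)), 1 :: real)"
  shows "dist (perpendicular_foot (0, 0) (tangent_line (right_branch a b) y)) (right_branch a b y)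
     = (a\<^sup>2 + b\<^sup>2) / b\<^sup>2 * y / norm v"
proof -
  let ?E = "right_branch a b y"
  have "v \<noteq> 0" by (simp add: v_def zero_prod_def)
  have "vector_derivative (right_branch a b) (at y) = v"
    unfolding v_def using assms(1) by (intro vector_derivative_at right_branch_has_vector_derivative)
  then have "perpendicular_foot (0, 0) (tangent_line (right_branch a b) y) - ?E
      = - ((?E \<bullet> v / (v \<bullet> v)) *\<^sub>R v)"
    using perpendicular_foot_line[OF \<open>v \<noteq> 0\<close>, of "(0, 0)" ?E]
    by (simp add: tangent_line_def flip: zero_prod_def)
  then have "dist (perpendicular_foot (0, 0) (tangent_line (right_branch a b) y)) ?E
      = \<bar>?E \<bullet> v\<bar> / norm v"
    using \<open>v \<noteq> 0\<close> by (simp add: dist_norm power2_norm_eq_inner[symmetric] power2_eq_square abs_mult)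
  also have "?E \<bullet> v = (a\<^sup>2 + b\<^sup>2) / b\<^sup>2 * y"
  proof -
    have "sqrt (1 + y\<^sup>2 / b\<^sup>2) > 0" by (simp add: add_pos_nonneg)
    then show ?thesis
      using assms(1) by (simp add: right_branch_def v_def field_simps power2_eq_square)
  qed
  finally show ?thesis using assms(1,2) by simp
qed

section \<open>The excess as an incomplete elliptic integral\<close>

text \<open>The arc length is evaluated through an explicit antiderivative of the speed in
  \<open>y\<close>: the tangent segment minus an antiderivative \<open>H\<close> of the integrand,
  taken at the amplitude. Subtracting it from the tangent segment leaves only an increment of
  \<open>H\<close>.\<close>

lemma excess_at_right_branch:
  assumes "a > 0" "b > 0" "y \<ge> 0"
  defines "c \<equiv> sqrt (a\<^sup>2 + b\<^sup>2)"
  shows "excess_at a b (right_branch a b y) = integral {0..arctan (c * y / b\<^sup>2)}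
    (\<lambda>\<theta>. c * sqrt (1 - (a / c)\<^sup>2 * (sin \<theta>)\<^sup>2) - b\<^sup>2 / c * (1 / sqrt (1 - (a / c)\<^sup>2 * (sin \<theta>)\<^sup>2)))"
proof -
  define k where "k = a / c"
  define \<Delta> where "\<Delta> \<theta> = sqrt (1 - k\<^sup>2 * (sin \<theta>)\<^sup>2)" for \<theta>
  define h where "h \<theta> = c * \<Delta> \<theta> - b\<^sup>2 / c * (1 / \<Delta> \<theta>)" for \<theta>
  define \<phi> where "\<phi> t = arctan (c * t / b\<^sup>2)" for t
  define v where "v t = (a * t / (b\<^sup>2 * sqrt (1 + t\<^sup>2 / b\<^sup>2)), 1 :: real)" for t
  have c: "c > 0" "c\<^sup>2 = a\<^sup>2 + b\<^sup>2"
    using assms by (simp_all add: c_def add_pos_pos)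
  have k: "k\<^sup>2 < 1" "c\<^sup>2 * (1 - k\<^sup>2) = b\<^sup>2"
    using assms c by (simp_all add: k_def power_divide field_simps)
  have rad_pos: "1 - k\<^sup>2 * (sin \<theta>)\<^sup>2 > 0" for \<theta>
  proof -
    have "k\<^sup>2 * (sin \<theta>)\<^sup>2 \<le> k\<^sup>2 * 1"
      by (intro mult_left_mono) (simp_all add: abs_square_le_1)
    then show ?thesis using k by linarith
  qed
  then have \<Delta>_pos: "\<Delta> \<theta> > 0" and \<Delta>_sq: "(\<Delta> \<theta>)\<^sup>2 = 1 - k\<^sup>2 * (sin \<theta>)\<^sup>2" for \<theta>
    by (simp_all add: \<Delta>_def less_imp_le)
  \<comment> \<open>Both squares are reduced to the same rational function of \<open>t\<close>;
    positivity of both sides then removes the squares.\<close>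
  have norm_v: "norm (v t) = 1 / \<Delta> (\<phi> t)" for t
  proof -
    have p: "1 + t\<^sup>2 / b\<^sup>2 > 0" "1 + (c * t / b\<^sup>2)\<^sup>2 > 0" "b\<^sup>2 + t\<^sup>2 > 0" "b^4 + c\<^sup>2 * t\<^sup>2 > 0"
      using assms(2) by (simp_all add: add_pos_nonneg)
    have "(norm (v t))\<^sup>2 = a\<^sup>2 * t\<^sup>2 / (b^4 * (1 + t\<^sup>2 / b\<^sup>2)) + 1"
      using p by (simp add: v_def norm_Pair power_divide power_mult_distrib)
    also have "\<dots> = (b^4 + c\<^sup>2 * t\<^sup>2) / (b\<^sup>2 * (b\<^sup>2 + t\<^sup>2))"
    proof -
      have "b^4 * (1 + t\<^sup>2 / b\<^sup>2) = b\<^sup>2 * (b\<^sup>2 + t\<^sup>2)"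
        using assms(2) by (simp add: field_simps power2_eq_square power4_eq_xxxx)
      moreover have "b^4 + c\<^sup>2 * t\<^sup>2 = a\<^sup>2 * t\<^sup>2 + b\<^sup>2 * (b\<^sup>2 + t\<^sup>2)"
        unfolding c(2) by (simp add: algebra_simps power2_eq_square power4_eq_xxxx)
      moreover have "b\<^sup>2 * (b\<^sup>2 + t\<^sup>2) \<noteq> 0"
        using p(3) assms(2) by simp
      ultimately show ?thesis
        by (simp only: add_divide_distrib divide_self simp_thms)
    qed
    finally have 1: "(norm (v t))\<^sup>2 = (b^4 + c\<^sup>2 * t\<^sup>2) / (b\<^sup>2 * (b\<^sup>2 + t\<^sup>2))" .
    have "(sin (\<phi> t))\<^sup>2 = (c * t / b\<^sup>2)\<^sup>2 / (1 + (c * t / b\<^sup>2)\<^sup>2)"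
      using p by (simp add: \<phi>_def sin_arctan power_divide power_mult_distrib)
    also have "\<dots> = c\<^sup>2 * t\<^sup>2 / (b^4 + c\<^sup>2 * t\<^sup>2)"
      using p assms(2) by (simp add: power_divide power_mult_distrib divide_simps)
    finally have "(\<Delta> (\<phi> t))\<^sup>2 = 1 - a\<^sup>2 * t\<^sup>2 / (b^4 + c\<^sup>2 * t\<^sup>2)"
      using c by (simp add: \<Delta>_sq k_def power_divide)
    also have "\<dots> = (b\<^sup>2 * (b\<^sup>2 + t\<^sup>2)) / (b^4 + c\<^sup>2 * t\<^sup>2)"
      using p(4) unfolding c(2) by (simp add: field_simps power2_eq_square power4_eq_xxxx)
    finally have "(norm (v t))\<^sup>2 = (1 / \<Delta> (\<phi> t))\<^sup>2"
      by (simp add: 1 power_divide)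
    then show ?thesis
      using \<Delta>_pos[of "\<phi> t"] by (simp add: power2_eq_iff_nonneg)
  qed
  have \<Delta>_cont: "continuous_on X \<Delta>" for X
    unfolding \<Delta>_def by (intro continuous_intros)
  \<comment> \<open>The interval contains all values of \<open>\<phi>\<close> in its interior, so
    \<open>H\<close> has a two-sided derivative at each of them, also at
    \<open>\<phi> 0 = 0\<close>.\<close>
  have "continuous_on {-pi..pi} h"
    unfolding h_def using \<Delta>_cont \<Delta>_pos by (intro continuous_intros) (auto simp: less_imp_neq[symmetric])
  then obtain H where H: "\<And>x. x \<in> {-pi..pi} \<Longrightarrow> (H has_vector_derivative h x) (at x within {-pi..pi})"
    using antiderivative_continuous by blast
  have \<phi>_bounds: "-pi < \<phi> t" "\<phi> t < pi" for t
    using arctan_bounded[of "c * t / b\<^sup>2"] pi_gt_zero unfolding \<phi>_def by linarith+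
  define F where "F t = c * tan (\<phi> t) * \<Delta> (\<phi> t) - H (\<phi> t)" for t
  have F: "(F has_vector_derivative norm (v t)) (at t)" for t
  proof -
    define \<theta> where "\<theta> = \<phi> t"
    have cos: "cos \<theta> \<noteq> 0" by (simp add: \<theta>_def \<phi>_def)
    have dH: "(H has_real_derivative h \<theta>) (at \<theta>)"
      using H[of \<theta>] \<phi>_bounds[of t]
      by (simp add: \<theta>_def at_within_Icc_at has_real_derivative_iff_has_vector_derivative)
    have d\<Delta>: "(\<Delta> has_real_derivative - (k\<^sup>2 * sin \<theta> * cos \<theta> / \<Delta> \<theta>)) (at \<theta>)"
      using rad_pos[of \<theta>] unfolding \<Delta>_def
      by (auto intro!: derivative_eq_intros simp: field_simps)
    have d\<phi>: "(\<phi> has_real_derivative c / b\<^sup>2 * (cos \<theta>)\<^sup>2) (at t)"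
    proof -
      \<comment> \<open>The derivative of \<open>arctan\<close> is thus the squared cosine of the
        amplitude, which later cancels the pole of the derivative of \<open>tan\<close>.\<close>
      have "(cos \<theta>)\<^sup>2 = inverse (1 + (c * t / b\<^sup>2)\<^sup>2)"
        by (simp add: \<theta>_def \<phi>_def cos_arctan power_divide inverse_eq_divide add_nonneg_nonneg)
      then show ?thesis
        unfolding \<phi>_def using assms(2) by (auto intro!: derivative_eq_intros simp: power4_eq_xxxx power2_eq_square[of b])
    qed
    have "((\<lambda>\<theta>. c * tan \<theta> * \<Delta> \<theta> - H \<theta>) has_real_derivative
        c * inverse ((cos \<theta>)\<^sup>2) * \<Delta> \<theta> + - (k\<^sup>2 * sin \<theta> * cos \<theta> / \<Delta> \<theta>) * (c * tan \<theta>) - h \<theta>) (at \<theta>)"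
      using cos dH d\<Delta> by (auto intro!: derivative_eq_intros)
    from DERIV_chain2[OF this[unfolded \<theta>_def] d\<phi>]
    have "(F has_real_derivative
        (c * inverse ((cos \<theta>)\<^sup>2) * \<Delta> \<theta> + - (k\<^sup>2 * sin \<theta> * cos \<theta> / \<Delta> \<theta>) * (c * tan \<theta>) - h \<theta>)
          * (c / b\<^sup>2 * (cos \<theta>)\<^sup>2)) (at t)"
      by (simp add: F_def[abs_def] \<theta>_def)
    also have "(c * inverse ((cos \<theta>)\<^sup>2) * \<Delta> \<theta> + - (k\<^sup>2 * sin \<theta> * cos \<theta> / \<Delta> \<theta>) * (c * tan \<theta>) - h \<theta>)
          * (c / b\<^sup>2 * (cos \<theta>)\<^sup>2) = norm (v t)"
    proof -
      have h: "h \<theta> = c * k\<^sup>2 * (cos \<theta>)\<^sup>2 / \<Delta> \<theta>"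
      proof -
        have "h \<theta> * \<Delta> \<theta> = c * (\<Delta> \<theta>)\<^sup>2 - b\<^sup>2 / c"
          using \<Delta>_pos[of \<theta>] by (simp add: h_def field_simps power2_eq_square)
        also have "b\<^sup>2 / c = c * (1 - k\<^sup>2)"
          unfolding k(2)[symmetric] using c(1) by (simp add: power2_eq_square)
        also have "c * (\<Delta> \<theta>)\<^sup>2 - \<dots> = c * k\<^sup>2 * (cos \<theta>)\<^sup>2"
          by (simp add: \<Delta>_sq sin_squared_eq algebra_simps)
        finally show ?thesis using \<Delta>_pos[of \<theta>] by (simp add: field_simps)
      qed
      have "(c * inverse ((cos \<theta>)\<^sup>2) * \<Delta> \<theta> + - (k\<^sup>2 * sin \<theta> * cos \<theta> / \<Delta> \<theta>) * (c * tan \<theta>) - h \<theta>)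
          * (c / b\<^sup>2 * (cos \<theta>)\<^sup>2)
        = c\<^sup>2 / b\<^sup>2 * ((\<Delta> \<theta>)\<^sup>2 - k\<^sup>2 * (cos \<theta>)\<^sup>2 * ((sin \<theta>)\<^sup>2 + (cos \<theta>)\<^sup>2)) / \<Delta> \<theta>"
      proof -
        \<comment> \<open>With \<open>S\<^sup>2 + C\<^sup>2\<close> left unsimplified, this is an
          identity of rational functions in independent variables; the trigonometric relation is
          used only afterwards.\<close>
        have "(c * inverse (C\<^sup>2) * D + - (k\<^sup>2 * S * C / D) * (c * (S / C)) - c * k\<^sup>2 * C\<^sup>2 / D)
            * (c / b\<^sup>2 * C\<^sup>2) = c\<^sup>2 / b\<^sup>2 * (D\<^sup>2 - k\<^sup>2 * C\<^sup>2 * (S\<^sup>2 + C\<^sup>2)) / D"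
          if "C \<noteq> 0" "D \<noteq> 0" for C S D :: real
          using that assms(2) by (simp add: divide_simps) algebra
        from this[OF cos, of "\<Delta> \<theta>" "sin \<theta>"] show ?thesis
          unfolding h tan_def using \<Delta>_pos[of \<theta>] by (simp only: less_imp_neq[symmetric] not_False_eq_True)
      qed
      also have "\<dots> = c\<^sup>2 * (1 - k\<^sup>2) / b\<^sup>2 / \<Delta> \<theta>"
        by (simp add: \<Delta>_sq cos_squared_eq) (simp add: algebra_simps)
      finally show ?thesis
        using assms(2) by (simp add: k(2) norm_v \<theta>_def)
    qed
    finally show ?thesis by (simp add: has_real_derivative_iff_has_vector_derivative)
  qed
  have "curve_length (right_branch a b) 0 y = integral {0..y} (\<lambda>t. norm (v t))"
  proof (rule curve_length_C1)
    show "(right_branch a b has_vector_derivative v t) (at t within {0..y})" for t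
      unfolding v_def using assms(2)
      by (rule has_vector_derivative_at_within[OF right_branch_has_vector_derivative])
    have "1 + t\<^sup>2 / b\<^sup>2 \<noteq> 0" for t
      using add_pos_nonneg[of 1 "t\<^sup>2 / b\<^sup>2"] by simp
    then show "continuous_on {0..y} v"
      unfolding v_def using assms(2) by (intro continuous_intros) auto
  qed (use assms in auto)
  also have "\<dots> = F y - F 0"
    using fundamental_theorem_of_calculus[OF \<open>y \<ge> 0\<close> has_vector_derivative_at_within[OF F]]
    by (rule integral_unique)
  \<comment> \<open>The tangent segment vanishes at the vertex. The value \<open>H 0\<close> is kept
    because \<open>H\<close> is known only up to a constant.\<close>
  also have "F 0 = - H 0" by (simp add: F_def \<phi>_def)
  finally have "excess_at a b (right_branch a b y)
      = c\<^sup>2 / b\<^sup>2 * y * \<Delta> (\<phi> y) - (F y + H 0)"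
    using tangent_foot_distance[OF assms(2,3), of a]
    by (simp add: excess_at_def right_branch_def[of a b y] c(2) norm_v[unfolded v_def])
  also have "c\<^sup>2 / b\<^sup>2 * y * \<Delta> (\<phi> y) = c * tan (\<phi> y) * \<Delta> (\<phi> y)"
    by (simp add: \<phi>_def tan_arctan power2_eq_square)
  also have "\<dots> - (F y + H 0) = H (\<phi> y) - H 0" by (simp add: F_def)
  also have "\<dots> = integral {0..\<phi> y} h"
  proof (rule integral_unique[symmetric], rule fundamental_theorem_of_calculus)
    show "0 \<le> \<phi> y" using assms c by (simp add: \<phi>_def)
    show "(H has_vector_derivative h x) (at x within {0..\<phi> y})" if "x \<in> {0..\<phi> y}" for x
      using that \<phi>_bounds[of y] by (intro has_vector_derivative_within_subset[OF H]) auto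
  qed
  finally show ?thesis by (simp add: h_def[abs_def] \<Delta>_def k_def \<phi>_def)
qed

section \<open>Passage to the limit\<close>

theorem theorem2p2:
  fixes a b :: real
  assumes "a \<ge> b" and "b > 0"
  shows "(hyperbolic_excess a b \<longlongrightarrow>
           sqrt (a\<^sup>2 + b\<^sup>2) * elliptic_E (a / sqrt (a\<^sup>2 + b\<^sup>2))
           - b\<^sup>2 / sqrt (a\<^sup>2 + b\<^sup>2) * elliptic_K (a / sqrt (a\<^sup>2 + b\<^sup>2))) (at_right 0)"
proof -
  define c where "c = sqrt (a\<^sup>2 + b\<^sup>2)"
  define \<Delta> where "\<Delta> \<theta> = sqrt (1 - (a / c)\<^sup>2 * (sin \<theta>)\<^sup>2)" for \<theta>
  define h where "h \<theta> = c * \<Delta> \<theta> - b\<^sup>2 / c * (1 / \<Delta> \<theta>)" for \<theta>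
  \<comment> \<open>The ordinate of the arc point at distance \<epsilon> from the asymptote, as
    found in \<open>arc_point_eq\<close>.\<close>
  define Y where "Y \<epsilon> = (a\<^sup>2 * b\<^sup>2 / (c * \<epsilon>) - c * \<epsilon>) / (2 * a)" for \<epsilon>
  have "a > 0" using assms by simp
  have c: "c > 0" "c\<^sup>2 = a\<^sup>2 + b\<^sup>2"
    using assms \<open>a > 0\<close> by (simp_all add: c_def add_pos_pos)
  have "1 - (a / c)\<^sup>2 * (sin \<theta>)\<^sup>2 > 0" for \<theta>
  proof -
    have "(a / c)\<^sup>2 * (sin \<theta>)\<^sup>2 \<le> (a / c)\<^sup>2 * 1"
      by (intro mult_left_mono) (simp_all add: abs_square_le_1)
    moreover have "(a / c)\<^sup>2 < 1"
      using \<open>b > 0\<close> by (simp add: c(2) power_divide divide_less_eq_1 add_pos_pos sum_power2_gt_zero_iff)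
    ultimately show ?thesis by linarith
  qed
  then have \<Delta>_pos: "\<Delta> \<theta> > 0" for \<theta> by (simp add: \<Delta>_def)
  have \<Delta>_cont: "continuous_on X \<Delta>" for X
    unfolding \<Delta>_def by (intro continuous_intros)
  have inv_\<Delta>_cont: "continuous_on X (\<lambda>\<theta>. 1 / \<Delta> \<theta>)" for X
    using \<Delta>_pos by (intro continuous_intros \<Delta>_cont) (auto simp: less_imp_neq[symmetric])
  have h_cont: "continuous_on X h" for X
    unfolding h_def by (intro continuous_intros \<Delta>_cont inv_\<Delta>_cont)
  \<comment> \<open>The formula for the excess is established only in this range of \<epsilon>,
    which suffices for a limit at 0 from the right.\<close>
  have ev: "\<forall>\<^sub>F \<epsilon> in at_right 0. 0 < \<epsilon> \<and> \<epsilon> < a * b / c"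
    using \<open>a > 0\<close> \<open>b > 0\<close> c(1) by (auto simp: eventually_at_right_field intro!: exI[of _ "a * b / c"])
  have Y_nonneg: "Y \<epsilon> \<ge> 0" if "0 < \<epsilon>" "\<epsilon> < a * b / c" for \<epsilon>
  proof -
    have "c * \<epsilon> < a * b" using that c by (simp add: field_simps)
    then have "(c * \<epsilon>)\<^sup>2 \<le> (a * b)\<^sup>2"
      using that(1) c(1) by (intro power_mono) auto
    then show ?thesis
      using that c \<open>a > 0\<close> by (simp add: Y_def field_simps power2_eq_square)
  qed
  have excess: "hyperbolic_excess a b \<epsilon> = integral {0..arctan (c * Y \<epsilon> / b\<^sup>2)} h"
    if "0 < \<epsilon>" "\<epsilon> < a * b / c" for \<epsilon>
  proof -
    have "excess_at a b (right_branch a b (Y \<epsilon>)) = integral {0..arctan (c * Y \<epsilon> / b\<^sup>2)} h"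
      using excess_at_right_branch[OF \<open>a > 0\<close> \<open>b > 0\<close> Y_nonneg[OF that]] by (simp add: h_def[abs_def] \<Delta>_def c_def)
    moreover have "arc_point a b \<epsilon> = right_branch a b (Y \<epsilon>)"
      using arc_point_eq[OF \<open>a > 0\<close> \<open>b > 0\<close>] that by (simp add: Y_def c_def)
    ultimately show ?thesis by (simp add: hyperbolic_excess_def)
  qed
  \<comment> \<open>The ordinate grows like
    \<open>a * b\<^sup>2 / (2 * c * \<epsilon>)\<close>.\<close>
  have "filterlim (\<lambda>\<epsilon>. c * Y \<epsilon> / b\<^sup>2) at_top (at_right 0)"
    unfolding Y_def using \<open>a > 0\<close> \<open>b > 0\<close> c(1) by real_asymp
  then have "((\<lambda>\<epsilon>. arctan (c * Y \<epsilon> / b\<^sup>2)) \<longlongrightarrow> pi / 2) (at_right 0)"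
    by (rule filterlim_compose[OF tendsto_arctan_at_top])
  \<comment> \<open>Since the modulus is below 1, \<open>h\<close> is continuous up to
    \<open>pi / 2\<close>, so the limit amounts to continuity of an indefinite integral at its
    endpoint. This continuity is one-sided, whence the membership in \<open>{0..pi/2}\<close> shown
    next.\<close>
  moreover have "continuous_on {0..pi/2} (\<lambda>x. integral {0..x} h)"
    by (intro indefinite_integral_continuous_1 integrable_continuous_real h_cont)
  moreover have "\<forall>\<^sub>F \<epsilon> in at_right 0. arctan (c * Y \<epsilon> / b\<^sup>2) \<in> {0..pi/2}"
    using ev
  proof eventually_elim
    case (elim \<epsilon>)
    then have "0 \<le> c * Y \<epsilon> / b\<^sup>2" using Y_nonneg[of \<epsilon>] c(1) by simp
    then show ?case using arctan_ubound[of "c * Y \<epsilon> / b\<^sup>2"] by simp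
  qed
  ultimately have "((\<lambda>\<epsilon>. integral {0..arctan (c * Y \<epsilon> / b\<^sup>2)} h) \<longlongrightarrow> integral {0..pi/2} h) (at_right 0)"
    by (intro continuous_on_tendsto_compose[where f = "\<lambda>x. integral {0..x} h"]) auto
  then have "(hyperbolic_excess a b \<longlongrightarrow> integral {0..pi/2} h) (at_right 0)"
    by (rule Lim_transform_eventually) (use ev in eventually_elim, simp add: excess)
  \<comment> \<open>Both summands of \<open>h\<close> are separately integrable, so linearity yields
    the two complete integrals.\<close>
  also have "integral {0..pi/2} h = c * elliptic_E (a / c) - b\<^sup>2 / c * elliptic_K (a / c)"
    unfolding h_def[abs_def] elliptic_E_def elliptic_K_def \<Delta>_def[symmetric]
    by (simp only: integral_diff integral_mult_right integrable_continuous_real continuous_on_mult_left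
        \<Delta>_cont inv_\<Delta>_cont)
  finally show ?thesis by (simp add: c_def)
qed

end
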